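(* Let $\beta\ge0$ and $0\le\gamma<1$. Then $\ln Z_N(\beta,\gamma)\ge\ln Z_N^{SK}(\beta,0)$ almost surely, and for every $t\ge0$ and every $N$, $$\mathbb{P}\Big(\ln Z_N(\beta,\gamma)-\ln Z_N^{SK}(\beta,0)\ge t\Big)\le\frac{e^{-t}}{\sqrt{1-\gamma}}.$$ In particular, if $\nu_N:=\operatorname{Var}\big(\ln Z_N^{SK}(\beta,0)\big)\to\infty$ as $N\to\infty$, then $$\frac{\ln Z_N(\beta,\gamma)-\ln Z_N^{SK}(\beta,0)}{\sqrt{\nu_N}}\longrightarrow0\quad\text{in probability.}$$
   Context: Let $(g_{ij})_{i<j}$ be i.i.d. standard Gaussian random variables. For $N\ge1$, $\sigma\in\Sigma_N:=\{-1,+1\}^N$, put $m(\sigma):=\frac1N\sum_{i=1}^N\sigma_i$ and $H_N^{SK}(\sigma):=\frac{\beta}{\sqrt N}\sum_{1\le i<j\le N}g_{ij}\sigma_i\sigma_j$. Define $$Z_N(\beta,\gamma):=\sum_{\sigma\in\Sigma_N}\exp\Big(H_N^{SK}(\sigma)+\frac{\gamma N}{2}m(\sigma)^2\Big),\qquad Z_N^{SK}(\beta,0):=\sum_{\sigma\in\Sigma_N}\exp\big(H_N^{SK}(\sigma)\big),$$ both built from the same disorder $(g_{ij})$. *)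

theory Defs
  imports "HOL-Probability.Probability"
begin

definition spin_configs :: "nat \<Rightarrow> (nat \<Rightarrow> real) set" where
  "spin_configs N = {1..N} \<rightarrow>\<^sub>E {-1, 1}"

definition magnetization :: "nat \<Rightarrow> (nat \<Rightarrow> real) \<Rightarrow> real" where
  "magnetization N \<sigma> = (1 / real N) * (\<Sum>i = 1..N. \<sigma> i)"

text \<open>In the following definitions the argument \<open>g\<close> is one realisation of the disorder; only its
  entries \<open>g i j\<close> with \<open>1 \<le> i < j \<le> N\<close> are used.\<close>

definition H_SK :: "real \<Rightarrow> nat \<Rightarrow> (nat \<Rightarrow> nat \<Rightarrow> real) \<Rightarrow> (nat \<Rightarrow> real) \<Rightarrow> real" where
  "H_SK \<beta> N g \<sigma> =
     \<beta> / sqrt (real N) * (\<Sum>(i, j) \<in> {(i, j). 1 \<le> i \<and> i < j \<and> j \<le> N}. g i j * \<sigma> i * \<sigma> j)"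

definition Z :: "real \<Rightarrow> real \<Rightarrow> nat \<Rightarrow> (nat \<Rightarrow> nat \<Rightarrow> real) \<Rightarrow> real" where
  "Z \<beta> \<gamma> N g =
     (\<Sum>\<sigma> \<in> spin_configs N. exp (H_SK \<beta> N g \<sigma> + \<gamma> * real N / 2 * (magnetization N \<sigma>)\<^sup>2))"

definition Z_SK :: "real \<Rightarrow> nat \<Rightarrow> (nat \<Rightarrow> nat \<Rightarrow> real) \<Rightarrow> real" where
  "Z_SK \<beta> N g = (\<Sum>\<sigma> \<in> spin_configs N. exp (H_SK \<beta> N g \<sigma>))"

definition (in prob_space) gaussian_disorder :: "('a \<Rightarrow> nat \<Rightarrow> nat \<Rightarrow> real) \<Rightarrow> bool" where
  "gaussian_disorder g \<longleftrightarrow>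
     indep_vars (\<lambda>_. borel) (\<lambda>(i, j) \<omega>. g \<omega> i j) {(i, j). 1 \<le> i \<and> i < j} \<and>
     (\<forall>i j. 1 \<le> i \<and> i < j \<longrightarrow> distributed M lborel (\<lambda>\<omega>. g \<omega> i j) std_normal_density)"

definition (in prob_space) tendsto_in_prob :: "(nat \<Rightarrow> 'a \<Rightarrow> real) \<Rightarrow> real \<Rightarrow> bool" where
  "tendsto_in_prob X c \<longleftrightarrow>
     (\<forall>\<epsilon>>0. (\<lambda>n. prob {\<omega> \<in> space M. \<bar>X n \<omega> - c\<bar> > \<epsilon>}) \<longlonglongrightarrow> 0)"

end

theory Submission
  imports Defs
begin

text \<open>
  A gauge transformation \<open>\<sigma> i \<mapsto> \<tau> i * \<sigma> i\<close> can be absorbed into the disorder by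
  \<open>g i j \<mapsto> \<tau> i * \<tau> j * g i j\<close>, which preserves its law. Hence the expected Gibbs
  measure of the SK model is uniform, and the expectation of the ratio of the two partition
  functions is the Curie-Weiss average of \<open>exp (\<gamma> * N / 2 * m\<^sup>2)\<close> over independent fair
  signs. Writing this exponential as a Gaussian integral of \<open>exp (sqrt (\<gamma> / N) * x * S)\<close>,
  with \<open>S\<close> the sum of the signs, and using \<open>cosh y \<le> exp (y\<^sup>2 / 2)\<close>, the average is at most
  \<open>1 / sqrt (1 - \<gamma>)\<close>. Markov's inequality then yields the tail bound.
\<close>

section \<open>Hyperbolic cosine bound and Gaussian integrals\<close>

lemma cosh_le_exp_half_square: "cosh x \<le> exp (x\<^sup>2 / 2)" for x :: real
proof -
  have *: "cosh x \<le> exp (x\<^sup>2 / 2)" if "x \<ge> 0" for x :: real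
  proof -
    \<comment> \<open>The inequality behind Hoeffding's lemma for a fair coin (p = 1/2) at h = 2x.
      The left side is \<open>ln (cosh x)\<close> and (2x)^2 / 8 = x^2 / 2. It needs h \<ge> 0;
      evenness of \<open>cosh\<close> covers the other sign.\<close>
    have "- (2 * x) * (1 / 2) + ln (1 + 1 / 2 * (exp (2 * x) - 1)) \<le> (2 * x)\<^sup>2 / 8"
      using that by (intro Hoeffdings_lemma_aux) auto
    also have "1 + 1 / 2 * (exp (2 * x) - 1) = exp x * cosh x"
      by (simp add: cosh_field_def field_simps flip: exp_add)
    also have "ln (exp x * cosh x) = x + ln (cosh x)"
      by (simp add: ln_mult cosh_real_pos)
    finally have "ln (cosh x) \<le> x\<^sup>2 / 2"
      by (simp add: power2_eq_square)
    thus ?thesis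
      by (metis cosh_real_pos exp_le_cancel_iff exp_ln)
  qed
  show ?thesis
    using *[of x] *[of "- x"] by (cases "x \<ge> 0") auto
qed

text \<open>Completing the square leaves a normal density with mean a. Read from right to left, this
  linearises the square in \<open>exp (a\<^sup>2 / 2)\<close>.\<close>

lemma has_bochner_integral_std_normal_exp:
  "has_bochner_integral lborel (\<lambda>x. std_normal_density x * exp (a * x)) (exp (a\<^sup>2 / 2))"
proof -
  have "std_normal_density x * exp (a * x) = exp (a\<^sup>2 / 2) * normal_density a 1 x" for x
  proof -
    have "- x\<^sup>2 / 2 + a * x = a\<^sup>2 / 2 + - (x - a)\<^sup>2 / 2"
      by (simp add: power2_eq_square field_simps)
    hence "exp (- x\<^sup>2 / 2) * exp (a * x) = exp (a\<^sup>2 / 2) * exp (- (x - a)\<^sup>2 / 2)"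
      by (simp only: exp_add [symmetric])
    thus ?thesis
      by (simp add: normal_density_def)
  qed
  thus ?thesis
    by (simp add: has_bochner_integral_iff)
qed

text \<open>The quadratic tilt only widens the bell curve: the integrand is s times the centred
  normal density with standard deviation s = 1 / sqrt (1 - c). This is the source of the factor 1 /
  sqrt (1 - \<gamma>).\<close>

lemma has_bochner_integral_std_normal_exp_square:
  assumes "c < 1"
  shows "has_bochner_integral lborel (\<lambda>x. std_normal_density x * exp (c * x\<^sup>2 / 2))
    (1 / sqrt (1 - c))"
proof -
  define s where "s = 1 / sqrt (1 - c)"
  have s: "s > 0" "s\<^sup>2 = 1 / (1 - c)"
    using assms by (simp_all add: s_def power_divide)
  have "std_normal_density x * exp (c * x\<^sup>2 / 2) = s * normal_density 0 s x" for x
  proof -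
    have "sqrt (2 * pi * s\<^sup>2) = s * sqrt (2 * pi)"
      using s(1) by (simp add: real_sqrt_mult)
    moreover have "- x\<^sup>2 / 2 + c * x\<^sup>2 / 2 = - x\<^sup>2 / (2 * s\<^sup>2)"
      using assms by (simp add: s(2) field_simps)
    hence "exp (- x\<^sup>2 / 2) * exp (c * x\<^sup>2 / 2) = exp (- x\<^sup>2 / (2 * s\<^sup>2))"
      by (simp only: exp_add [symmetric])
    ultimately show ?thesis
      using s(1) by (simp add: normal_density_def)
  qed
  thus ?thesis
    using s(1) by (simp add: has_bochner_integral_iff flip: s_def)
qed

section \<open>Spin configurations and the Curie-Weiss sum\<close>

lemma finite_spin_configs [simp, intro]: "finite (spin_configs N)"
  by (auto simp: spin_configs_def intro!: finite_PiE)

lemma card_spin_configs [simp]: "card (spin_configs N) = 2 ^ N"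
  by (simp add: spin_configs_def card_PiE numeral_2_eq_2)

lemma spin_configs_cases:
  assumes "\<sigma> \<in> spin_configs N" "i \<in> {1..N}"
  shows "\<sigma> i = -1 \<or> \<sigma> i = 1"
  using PiE_mem [OF assms [unfolded spin_configs_def]] by simp

lemma restrict_spin_config:
  assumes "\<sigma> \<in> spin_configs N"
  shows "restrict \<sigma> {1..N} = \<sigma>"
  using assms unfolding spin_configs_def by (rule PiE_restrict)

text \<open>The exponential factorises over sites, so the sum over the product set is a product of N
  equal one-site sums.\<close>

lemma sum_spin_configs_exp:
  "(\<Sum>\<sigma>\<in>spin_configs N. exp (a * (\<Sum>i = 1..N. \<sigma> i))) = 2 ^ N * cosh a ^ N"
proof -
  have "(\<Sum>\<sigma>\<in>spin_configs N. exp (a * (\<Sum>i = 1..N. \<sigma> i)))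
      = (\<Sum>\<sigma>\<in>{1..N} \<rightarrow>\<^sub>E {-1, 1}. \<Prod>i = 1..N. exp (a * \<sigma> i))"
    by (simp add: spin_configs_def sum_distrib_left exp_sum)
  also have "\<dots> = (\<Prod>i = 1..N. \<Sum>s\<in>{-1, 1}. exp (a * s))"
    by (rule prod_sum_PiE [symmetric]) auto
  also have "(\<Sum>s\<in>{-1, 1}. exp (a * s)) = 2 * cosh a"
    by (simp add: cosh_field_def)
  finally show ?thesis
    by (simp add: power_mult_distrib)
qed

lemma sum_spin_configs_Curie_Weiss_le:
  assumes "N \<ge> 1" "0 \<le> \<gamma>" "\<gamma> < 1"
  shows "(\<Sum>\<sigma>\<in>spin_configs N. exp (\<gamma> * real N / 2 * (magnetization N \<sigma>)\<^sup>2))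
    \<le> 2 ^ N / sqrt (1 - \<gamma>)"
proof -
  \<comment> \<open>Chosen so that \<open>(b * S \<sigma>)\<^sup>2 / 2\<close> is the Curie-Weiss
    exponent, since S = N m.\<close>
  define b where "b = sqrt (\<gamma> / N)"
  define S where "S = (\<lambda>\<sigma> :: nat \<Rightarrow> real. \<Sum>i = 1..N. \<sigma> i)"
  have b: "b\<^sup>2 = \<gamma> / N"
    using assms by (simp add: b_def)
  have 1: "has_bochner_integral lborel
      (\<lambda>x. \<Sum>\<sigma>\<in>spin_configs N. std_normal_density x * exp (b * S \<sigma> * x))
      (\<Sum>\<sigma>\<in>spin_configs N. exp ((b * S \<sigma>)\<^sup>2 / 2))"
    by (intro has_bochner_integral_sum has_bochner_integral_std_normal_exp)
  have 2: "has_bochner_integral lborel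
      (\<lambda>x. 2 ^ N * (std_normal_density x * exp (\<gamma> * x\<^sup>2 / 2))) (2 ^ N * (1 / sqrt (1 - \<gamma>)))"
    by (intro has_bochner_integral_mult_right has_bochner_integral_std_normal_exp_square assms)
  \<comment> \<open>Under the Gaussian integral the sum over configurations is explicit. The N-th
    power of the \<open>cosh\<close> bound has exponent N b^2 x^2 / 2 = \<gamma> x^2 / 2, so N
    disappears apart from the factor 2^N.\<close>
  have le: "(\<Sum>\<sigma>\<in>spin_configs N. std_normal_density x * exp (b * S \<sigma> * x))
      \<le> 2 ^ N * (std_normal_density x * exp (\<gamma> * x\<^sup>2 / 2))" for x
  proof -
    have "(\<Sum>\<sigma>\<in>spin_configs N. std_normal_density x * exp (b * S \<sigma> * x))
        = std_normal_density x * (2 ^ N * cosh (b * x) ^ N)"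
      by (simp add: S_def sum_distrib_left [symmetric] sum_spin_configs_exp [symmetric] mult_ac)
    also have "\<dots> \<le> std_normal_density x * (2 ^ N * exp ((b * x)\<^sup>2 / 2) ^ N)"
      by (intro mult_left_mono power_mono cosh_le_exp_half_square) simp_all
    also have "exp ((b * x)\<^sup>2 / 2) ^ N = exp (\<gamma> * x\<^sup>2 / 2)"
      using assms(1) by (simp add: b power_mult_distrib flip: exp_of_nat_mult)
    finally show ?thesis
      by (simp add: mult_ac)
  qed
  have "exp (\<gamma> * real N / 2 * (magnetization N \<sigma>)\<^sup>2) = exp ((b * S \<sigma>)\<^sup>2 / 2)" for \<sigma>
    using assms(1)
    by (simp add: magnetization_def S_def b power_mult_distrib power_divide power2_eq_square [of "real N"])
  thus ?thesis
    using integral_mono [OF integrable.intros [OF 1] integrable.intros [OF 2] le]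
    unfolding has_bochner_integral_integral_eq [OF 1] has_bochner_integral_integral_eq [OF 2]
    by simp
qed

section \<open>Measurability and Gibbs weights\<close>

abbreviation spin_pairs :: "nat \<Rightarrow> (nat \<times> nat) set" where
  "spin_pairs N \<equiv> {(i, j). 1 \<le> i \<and> i < j \<and> j \<le> N}"

lemma H_SK_cong:
  assumes "\<And>i j. (i, j) \<in> spin_pairs N \<Longrightarrow> g i j = h i j"
  shows "H_SK \<beta> N g \<sigma> = H_SK \<beta> N h \<sigma>"
  unfolding H_SK_def by (intro arg_cong2 [where f = "(*)"] sum.cong refl) (use assms in auto)

text \<open>Measurability is asked only on \<open>spin_pairs N\<close>, because
  \<open>gaussian_disorder\<close> says nothing about entries with i \<ge> j.\<close>

lemma borel_measurable_H_SK:
  assumes "\<And>i j. (i, j) \<in> spin_pairs N \<Longrightarrow> (\<lambda>\<omega>. g \<omega> i j) \<in> borel_measurable M"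
  shows "(\<lambda>\<omega>. H_SK \<beta> N (g \<omega>) \<sigma>) \<in> borel_measurable M"
  unfolding H_SK_def
  by (intro borel_measurable_times borel_measurable_const borel_measurable_sum)
    (use assms in \<open>auto intro!: borel_measurable_times\<close>)

lemma Z_SK_pos: "Z_SK \<beta> N g > 0"
proof -
  have "spin_configs N \<noteq> {}"
    using card_spin_configs [of N] by (metis card.empty power_not_zero zero_neq_numeral)
  thus ?thesis
    unfolding Z_SK_def by (intro sum_pos) auto
qed

lemma Z_SK_le_Z:
  assumes "0 \<le> \<gamma>"
  shows "Z_SK \<beta> N g \<le> Z \<beta> \<gamma> N g"
  unfolding Z_SK_def Z_def using assms by (intro sum_mono) simp

text \<open>The probability of \<sigma> under the SK Gibbs measure at fixed disorder. On
  configurations it lies in [0, 1], so integrability needs no estimate on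
  \<open>Z_SK\<close>.\<close>

definition gibbs :: "real \<Rightarrow> nat \<Rightarrow> (nat \<Rightarrow> nat \<Rightarrow> real) \<Rightarrow> (nat \<Rightarrow> real) \<Rightarrow> real" where
  "gibbs \<beta> N g \<sigma> = exp (H_SK \<beta> N g \<sigma>) / Z_SK \<beta> N g"

lemma gibbs_nonneg: "gibbs \<beta> N g \<sigma> \<ge> 0"
  using Z_SK_pos [of \<beta> N g] by (simp add: gibbs_def)

lemma sum_gibbs: "(\<Sum>\<sigma>\<in>spin_configs N. gibbs \<beta> N g \<sigma>) = 1"
  using Z_SK_pos [of \<beta> N g] by (simp add: gibbs_def Z_SK_def flip: sum_divide_distrib)

lemma gibbs_le_1:
  assumes "\<sigma> \<in> spin_configs N"
  shows "gibbs \<beta> N g \<sigma> \<le> 1"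
  using member_le_sum [OF assms, of "gibbs \<beta> N g"]
  by (simp add: sum_gibbs gibbs_nonneg)

lemma gibbs_cong:
  assumes "\<And>i j. (i, j) \<in> spin_pairs N \<Longrightarrow> g i j = h i j"
  shows "gibbs \<beta> N g \<sigma> = gibbs \<beta> N h \<sigma>"
  using H_SK_cong [of N g h, OF assms] by (simp add: gibbs_def Z_SK_def)

lemma borel_measurable_gibbs:
  assumes "\<And>i j. (i, j) \<in> spin_pairs N \<Longrightarrow> (\<lambda>\<omega>. g \<omega> i j) \<in> borel_measurable M"
  shows "(\<lambda>\<omega>. gibbs \<beta> N (g \<omega>) \<sigma>) \<in> borel_measurable M"
  unfolding gibbs_def Z_SK_def
  by (intro borel_measurable_divide borel_measurable_sum measurable_compose [OF _ borel_measurable_exp]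
      borel_measurable_H_SK assms)

text \<open>The ratio is the Gibbs average of a weight that does not depend on the disorder; its
  expectation is therefore determined by the expected Gibbs weights.\<close>

lemma Z_divide_Z_SK:
  "Z \<beta> \<gamma> N g / Z_SK \<beta> N g =
    (\<Sum>\<sigma>\<in>spin_configs N. exp (\<gamma> * real N / 2 * (magnetization N \<sigma>)\<^sup>2) * gibbs \<beta> N g \<sigma>)"
  by (simp add: Z_def gibbs_def exp_add sum_divide_distrib mult_ac)

section \<open>Gauge transformations at fixed disorder\<close>

lemma H_SK_gauge:
  "H_SK \<beta> N (\<lambda>i j. \<tau> i * \<tau> j * g i j) \<sigma> = H_SK \<beta> N g (\<lambda>i\<in>{1..N}. \<tau> i * \<sigma> i)"
  unfolding H_SK_def by (intro arg_cong2 [where f = "(*)"] sum.cong refl) auto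

text \<open>The map is its own inverse, as \<open>\<tau> i * \<tau> i = 1\<close>. Restricting to
  \<open>{1..N}\<close> keeps its values extensional, as \<open>spin_configs\<close>
  demands.\<close>

lemma bij_betw_spin_configs_gauge:
  assumes "\<tau> \<in> spin_configs N"
  shows "bij_betw (\<lambda>\<sigma>. \<lambda>i\<in>{1..N}. \<tau> i * \<sigma> i) (spin_configs N) (spin_configs N)"
proof (rule bij_betwI [where g = "\<lambda>\<sigma>. \<lambda>i\<in>{1..N}. \<tau> i * \<sigma> i"])
  have "(\<lambda>i\<in>{1..N}. \<tau> i * \<sigma> i) \<in> spin_configs N" if "\<sigma> \<in> spin_configs N" for \<sigma>
  proof -
    have "\<tau> i * \<sigma> i \<in> {-1, 1}" if "i \<in> {1..N}" for i
      using spin_configs_cases [OF assms that] spin_configs_cases [OF \<open>\<sigma> \<in> _\<close> that] by auto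
    thus ?thesis
      by (simp add: spin_configs_def)
  qed
  thus "(\<lambda>\<sigma>. \<lambda>i\<in>{1..N}. \<tau> i * \<sigma> i) \<in> spin_configs N \<rightarrow> spin_configs N"
    by blast
  thus "(\<lambda>\<sigma>. \<lambda>i\<in>{1..N}. \<tau> i * \<sigma> i) \<in> spin_configs N \<rightarrow> spin_configs N" .
  show "(\<lambda>i\<in>{1..N}. \<tau> i * (\<lambda>i\<in>{1..N}. \<tau> i * \<sigma> i) i) = \<sigma>" if "\<sigma> \<in> spin_configs N" for \<sigma>
  proof -
    have "\<tau> i * \<tau> i = 1" if "i \<in> {1..N}" for i
      using spin_configs_cases [OF assms that] by auto
    hence "(\<lambda>i\<in>{1..N}. \<tau> i * (\<lambda>i\<in>{1..N}. \<tau> i * \<sigma> i) i) = restrict \<sigma> {1..N}"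
      by (intro restrict_ext) (simp flip: mult.assoc)
    thus ?thesis
      using restrict_spin_config [OF that] by simp
  qed
  thus "(\<lambda>i\<in>{1..N}. \<tau> i * (\<lambda>i\<in>{1..N}. \<tau> i * \<sigma> i) i) = \<sigma>" if "\<sigma> \<in> spin_configs N" for \<sigma>
    using that .
qed

lemma Z_SK_gauge:
  assumes "\<tau> \<in> spin_configs N"
  shows "Z_SK \<beta> N (\<lambda>i j. \<tau> i * \<tau> j * g i j) = Z_SK \<beta> N g"
  unfolding Z_SK_def H_SK_gauge
  by (rule sum.reindex_bij_betw [OF bij_betw_spin_configs_gauge [OF assms]])

text \<open>The gauge map sends the all-ones configuration to \<tau>. Every Gibbs weight is thus one
  fixed function evaluated at a sign-flipped disorder.\<close>

lemma gibbs_gauge: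
  assumes "\<tau> \<in> spin_configs N"
  shows "gibbs \<beta> N (\<lambda>i j. \<tau> i * \<tau> j * g i j) (\<lambda>i\<in>{1..N}. 1) = gibbs \<beta> N g \<tau>"
proof -
  have "(\<lambda>i\<in>{1..N}. \<tau> i * (\<lambda>i\<in>{1..N}. 1) i) = restrict \<tau> {1..N}"
    by (rule restrict_ext) simp
  also have "\<dots> = \<tau>"
    by (rule restrict_spin_config [OF assms])
  finally show ?thesis
    by (simp add: gibbs_def Z_SK_gauge [OF assms] H_SK_gauge)
qed

section \<open>Sign-flip invariance and the expected Gibbs measure\<close>

context prob_space
begin

text \<open>By independence both joint laws are products of their marginals, and the marginals agree
  because the standard normal law is symmetric.\<close>

lemma distr_sign_flip:
  fixes X :: "'i \<Rightarrow> 'a \<Rightarrow> real"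
  assumes indep: "indep_vars (\<lambda>_. borel) X I"
    and normal: "\<And>i. i \<in> I \<Longrightarrow> distributed M lborel (X i) std_normal_density"
    and s: "\<And>i. i \<in> I \<Longrightarrow> s i \<in> {-1, 1}"
  shows "distr M (\<Pi>\<^sub>M i\<in>I. borel) (\<lambda>\<omega>. \<lambda>i\<in>I. s i * X i \<omega>)
    = distr M (\<Pi>\<^sub>M i\<in>I. borel) (\<lambda>\<omega>. \<lambda>i\<in>I. X i \<omega>)"
\<comment> \<open>The product characterisation of independence used below needs a nonempty index
  set. The empty case does occur: there are no pairs when N \<le> 1.\<close>
proof (cases "I = {}")
  case False
  have rv: "random_variable borel (X i)" if "i \<in> I" for i
    using distributed_measurable [OF normal [OF that]] by simp
  have indep': "indep_vars (\<lambda>_. borel) (\<lambda>i \<omega>. s i * X i \<omega>) I"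
    by (rule indep_vars_compose2 [OF indep]) measurable
  have eq: "distr M borel (\<lambda>\<omega>. s i * X i \<omega>) = distr M borel (X i)" if "i \<in> I" for i
  proof -
    have "distributed M lborel (\<lambda>\<omega>. 0 + s i * X i \<omega>)
        (normal_density (0 + s i * 0) (\<bar>s i\<bar> * 1))"
      using s [OF that] by (intro normal_density_affine normal that) auto
    hence "distributed M lborel (\<lambda>\<omega>. s i * X i \<omega>) std_normal_density"
      using s [OF that] by auto
    thus ?thesis
      using distributed_distr_eq_density [OF normal [OF that]] distributed_distr_eq_density
      by (fastforce cong: distr_cong)
  qed
  have "distr M (\<Pi>\<^sub>M i\<in>I. borel) (\<lambda>\<omega>. \<lambda>i\<in>I. s i * X i \<omega>)
      = (\<Pi>\<^sub>M i\<in>I. distr M borel (\<lambda>\<omega>. s i * X i \<omega>))"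
    using indep' by (subst (asm) indep_vars_iff_distr_eq_PiM' [OF False])
      (auto intro!: borel_measurable_times rv)
  also have "\<dots> = (\<Pi>\<^sub>M i\<in>I. distr M borel (X i))"
    by (intro PiM_cong refl eq)
  also have "\<dots> = distr M (\<Pi>\<^sub>M i\<in>I. borel) (\<lambda>\<omega>. \<lambda>i\<in>I. X i \<omega>)"
    using indep by (subst (asm) indep_vars_iff_distr_eq_PiM' [OF False]) (auto intro: rv)
  finally show ?thesis .
qed (simp add: restrict_def)

lemma gaussian_disorder_measurable:
  assumes "gaussian_disorder g" "(i, j) \<in> spin_pairs N"
  shows "(\<lambda>\<omega>. g \<omega> i j) \<in> borel_measurable M"
proof -
  have "distributed M lborel (\<lambda>\<omega>. g \<omega> i j) std_normal_density"
    using assms by (auto simp: gaussian_disorder_def)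
  thus ?thesis
    using distributed_measurable by fastforce
qed

lemma gibbs_measurable:
  assumes "gaussian_disorder g"
  shows "(\<lambda>\<omega>. gibbs \<beta> N (g \<omega>) \<sigma>) \<in> borel_measurable M"
  by (intro borel_measurable_gibbs gaussian_disorder_measurable [OF assms])

lemma integrable_gibbs:
  assumes "gaussian_disorder g" "\<sigma> \<in> spin_configs N"
  shows "integrable M (\<lambda>\<omega>. gibbs \<beta> N (g \<omega>) \<sigma>)"
  by (intro integrable_const_bound [where B = 1] gibbs_measurable assms)
    (use assms in \<open>auto simp: gibbs_nonneg gibbs_le_1\<close>)

lemma expectation_gibbs_gauge:
  assumes g: "gaussian_disorder g" and \<tau>: "\<tau> \<in> spin_configs N"
  shows "expectation (\<lambda>\<omega>. gibbs \<beta> N (g \<omega>) \<tau>) = expectation (\<lambda>\<omega>. gibbs \<beta> N (g \<omega>) (\<lambda>i\<in>{1..N}. 1))"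
proof -
  let ?I = "spin_pairs N"
  let ?P = "\<Pi>\<^sub>M p\<in>?I. (borel :: real measure)"
  define X where "X = (\<lambda>(i, j) \<omega>. g \<omega> i j)"
  define s where "s = (\<lambda>(i, j). \<tau> i * \<tau> j)"
  \<comment> \<open>The all-ones weight as a function of the disorder vector. Both expectations are
    integrals of \<open>F\<close>, against the laws of the flipped and the original vector.\<close>
  define F where "F = (\<lambda>x :: nat \<times> nat \<Rightarrow> real. gibbs \<beta> N (\<lambda>i j. x (i, j)) (\<lambda>i\<in>{1..N}. 1))"
  have F [measurable]: "F \<in> borel_measurable ?P"
    unfolding F_def by (rule borel_measurable_gibbs) (rule measurable_component_singleton)
  have normal: "distributed M lborel (X p) std_normal_density" if "p \<in> ?I" for p
    using g that by (auto simp: gaussian_disorder_def X_def)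
  have [measurable]: "random_variable borel (X p)" if "p \<in> ?I" for p
    using distributed_measurable [OF normal [OF that]] by simp
  have indep: "indep_vars (\<lambda>_. borel) X ?I"
    using g unfolding gaussian_disorder_def X_def by (blast intro: indep_vars_subset)
  have s: "s p \<in> {-1, 1}" if "p \<in> ?I" for p
    using that spin_configs_cases [OF \<tau>, of "fst p"] spin_configs_cases [OF \<tau>, of "snd p"]
    by (auto simp: s_def)
  have "gibbs \<beta> N (g \<omega>) \<tau> = F (\<lambda>p\<in>?I. s p * X p \<omega>)" for \<omega>
    unfolding F_def gibbs_gauge [OF \<tau>, symmetric] by (rule gibbs_cong) (auto simp: s_def X_def)
  with F have "expectation (\<lambda>\<omega>. gibbs \<beta> N (g \<omega>) \<tau>)
      = (\<integral>x. F x \<partial>distr M ?P (\<lambda>\<omega>. \<lambda>p\<in>?I. s p * X p \<omega>))"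
    by (subst integral_distr) auto
  also have "\<dots> = (\<integral>x. F x \<partial>distr M ?P (\<lambda>\<omega>. \<lambda>p\<in>?I. X p \<omega>))"
    by (simp only: distr_sign_flip [OF indep normal s])
  also have "\<dots> = expectation (\<lambda>\<omega>. F (\<lambda>p\<in>?I. X p \<omega>))"
    using F by (subst integral_distr) auto
  also have "(\<lambda>\<omega>. F (\<lambda>p\<in>?I. X p \<omega>)) = (\<lambda>\<omega>. gibbs \<beta> N (g \<omega>) (\<lambda>i\<in>{1..N}. 1))"
    unfolding F_def by (intro ext gibbs_cong) (auto simp: X_def)
  finally show ?thesis .
qed

text \<open>The 2^N expected weights are all equal and add up to 1.\<close>

lemma expectation_gibbs:
  assumes g: "gaussian_disorder g" and \<tau>: "\<tau> \<in> spin_configs N"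
  shows "expectation (\<lambda>\<omega>. gibbs \<beta> N (g \<omega>) \<tau>) = 1 / 2 ^ N"
proof -
  have "1 = expectation (\<lambda>\<omega>. \<Sum>\<sigma>\<in>spin_configs N. gibbs \<beta> N (g \<omega>) \<sigma>)"
    by (simp add: sum_gibbs prob_space)
  also have "\<dots> = (\<Sum>\<sigma>\<in>spin_configs N. expectation (\<lambda>\<omega>. gibbs \<beta> N (g \<omega>) \<sigma>))"
    by (intro Bochner_Integration.integral_sum integrable_gibbs g)
  also have "\<dots> = (\<Sum>\<sigma>\<in>spin_configs N. expectation (\<lambda>\<omega>. gibbs \<beta> N (g \<omega>) \<tau>))"
    by (intro sum.cong refl) (simp add: expectation_gibbs_gauge [OF g] \<tau>)
  also have "\<dots> = 2 ^ N * expectation (\<lambda>\<omega>. gibbs \<beta> N (g \<omega>) \<tau>)"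
    by simp
  finally show ?thesis
    by (simp add: field_simps)
qed

lemma integrable_Z_divide_Z_SK:
  assumes "gaussian_disorder g"
  shows "integrable M (\<lambda>\<omega>. Z \<beta> \<gamma> N (g \<omega>) / Z_SK \<beta> N (g \<omega>))"
  unfolding Z_divide_Z_SK by (intro Bochner_Integration.integrable_sum integrable_mult_right integrable_gibbs assms)

lemma expectation_Z_divide_Z_SK_le:
  assumes g: "gaussian_disorder g" and "N \<ge> 1" "0 \<le> \<gamma>" "\<gamma> < 1"
  shows "expectation (\<lambda>\<omega>. Z \<beta> \<gamma> N (g \<omega>) / Z_SK \<beta> N (g \<omega>)) \<le> 1 / sqrt (1 - \<gamma>)"
proof -
  let ?w = "\<lambda>\<sigma>. exp (\<gamma> * real N / 2 * (magnetization N \<sigma>)\<^sup>2)"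
  have "expectation (\<lambda>\<omega>. Z \<beta> \<gamma> N (g \<omega>) / Z_SK \<beta> N (g \<omega>))
      = (\<Sum>\<sigma>\<in>spin_configs N. expectation (\<lambda>\<omega>. ?w \<sigma> * gibbs \<beta> N (g \<omega>) \<sigma>))"
    unfolding Z_divide_Z_SK
    by (intro Bochner_Integration.integral_sum integrable_mult_right integrable_gibbs g)
  also have "\<dots> = (\<Sum>\<sigma>\<in>spin_configs N. ?w \<sigma> * (1 / 2 ^ N))"
    by (intro sum.cong refl) (simp only: integral_mult_right_zero expectation_gibbs [OF g])
  also have "\<dots> = (\<Sum>\<sigma>\<in>spin_configs N. ?w \<sigma>) / 2 ^ N"
    by (simp add: sum_divide_distrib)
  also have "\<dots> \<le> (2 ^ N / sqrt (1 - \<gamma>)) / 2 ^ N"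
    by (intro divide_right_mono sum_spin_configs_Curie_Weiss_le assms) simp
  finally show ?thesis
    by simp
qed

lemma prob_ln_Z_diff_ge:
  assumes g: "gaussian_disorder g" and "N \<ge> 1" "0 \<le> \<gamma>" "\<gamma> < 1"
  shows "prob {\<omega> \<in> space M. ln (Z \<beta> \<gamma> N (g \<omega>)) - ln (Z_SK \<beta> N (g \<omega>)) \<ge> t}
    \<le> exp (- t) / sqrt (1 - \<gamma>)"
proof -
  let ?R = "\<lambda>\<omega>. Z \<beta> \<gamma> N (g \<omega>) / Z_SK \<beta> N (g \<omega>)"
  have pos: "Z \<beta> \<gamma> N h > 0" for h
    using Z_SK_le_Z [OF \<open>0 \<le> \<gamma>\<close>] Z_SK_pos by (rule less_le_trans [rotated])
  \<comment> \<open>Exponentiating turns the event into one about the ratio, to which Markov's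
    inequality applies at level \<open>exp t\<close>.\<close>
  have "ln (Z \<beta> \<gamma> N h) - ln (Z_SK \<beta> N h) \<ge> t \<longleftrightarrow> Z \<beta> \<gamma> N h / Z_SK \<beta> N h \<ge> exp t" for h
    using pos [of h] Z_SK_pos [of \<beta> N h] by (simp add: ln_ge_iff flip: ln_divide_pos)
  hence "prob {\<omega> \<in> space M. ln (Z \<beta> \<gamma> N (g \<omega>)) - ln (Z_SK \<beta> N (g \<omega>)) \<ge> t}
      = prob {\<omega> \<in> space M. ?R \<omega> \<ge> exp t}"
    by simp
  also have "\<dots> \<le> expectation ?R / exp t"
    using pos Z_SK_pos
    by (intro integral_Markov_inequality_measure [where A = "{}"] integrable_Z_divide_Z_SK g)
      (auto intro!: AE_I2 divide_nonneg_nonneg less_imp_le)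
  also have "\<dots> \<le> (1 / sqrt (1 - \<gamma>)) / exp t"
    by (intro divide_right_mono expectation_Z_divide_Z_SK_le assms) simp
  finally show ?thesis
    by (simp add: exp_minus field_simps)
qed

text \<open>The tail bound has a constant independent of N, so at t = \<epsilon> sqrt (\<nu> N) it
  tends to 0 for any diverging \<nu>.\<close>

lemma ln_Z_diff_tendsto_in_prob:
  assumes g: "gaussian_disorder g" and "0 \<le> \<gamma>" "\<gamma> < 1"
    and \<nu>: "filterlim \<nu> at_top sequentially"
  shows "tendsto_in_prob
    (\<lambda>N \<omega>. (ln (Z \<beta> \<gamma> N (g \<omega>)) - ln (Z_SK \<beta> N (g \<omega>))) / sqrt (\<nu> N)) 0"
  unfolding tendsto_in_prob_def
proof (intro allI impI)
  fix \<epsilon> :: real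
  assume "\<epsilon> > 0"
  let ?D = "\<lambda>N \<omega>. ln (Z \<beta> \<gamma> N (g \<omega>)) - ln (Z_SK \<beta> N (g \<omega>))"
  \<comment> \<open>Monotonicity of the measure requires the larger event to be measurable.\<close>
  have meas: "{\<omega> \<in> space M. ?D N \<omega> \<ge> t} \<in> events" for N t
  proof -
    have "(\<lambda>\<omega>. Z \<beta> \<gamma> N (g \<omega>)) \<in> borel_measurable M" "(\<lambda>\<omega>. Z_SK \<beta> N (g \<omega>)) \<in> borel_measurable M"
      unfolding Z_def Z_SK_def
      by (intro borel_measurable_sum measurable_compose [OF _ borel_measurable_exp]
          borel_measurable_add borel_measurable_const borel_measurable_H_SK
          gaussian_disorder_measurable [OF g]; assumption)+
    thus ?thesis
      by measurable
  qed
  show "(\<lambda>N. prob {\<omega> \<in> space M. \<bar>?D N \<omega> / sqrt (\<nu> N) - 0\<bar> > \<epsilon>}) \<longlonglongrightarrow> 0"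
  proof (rule tendsto_sandwich [OF _ _ tendsto_const])
    have "filterlim (\<lambda>N. \<epsilon> * sqrt (\<nu> N)) at_top sequentially"
      using \<open>\<epsilon> > 0\<close>
      by (intro filterlim_tendsto_pos_mult_at_top [OF tendsto_const]
          filterlim_compose [OF sqrt_at_top \<nu>])
    hence "(\<lambda>N. exp (- (\<epsilon> * sqrt (\<nu> N)))) \<longlonglongrightarrow> 0"
      by (intro filterlim_compose [OF exp_at_bot])
        (auto simp: filterlim_uminus_at_top)
    thus "(\<lambda>N. exp (- (\<epsilon> * sqrt (\<nu> N))) / sqrt (1 - \<gamma>)) \<longlonglongrightarrow> 0"
      by (rule tendsto_divide_zero)
    show "\<forall>\<^sub>F N in sequentially. prob {\<omega> \<in> space M. \<bar>?D N \<omega> / sqrt (\<nu> N) - 0\<bar> > \<epsilon>}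
        \<le> exp (- (\<epsilon> * sqrt (\<nu> N))) / sqrt (1 - \<gamma>)"
      \<comment> \<open>Eventually \<nu> N > 0, so the division can be cleared, and N \<ge> 1, as
        the tail bound requires.\<close>
      using filterlim_at_top_dense [THEN iffD1, OF \<nu>, rule_format, of 0] eventually_ge_at_top [of 1]
    proof eventually_elim
      case (elim N)
      have "?D N \<omega> \<ge> 0" for \<omega>
        using Z_SK_le_Z [OF \<open>0 \<le> \<gamma>\<close>, of \<beta> N "g \<omega>"] Z_SK_pos [of \<beta> N "g \<omega>"] by simp
      hence "{\<omega> \<in> space M. \<bar>?D N \<omega> / sqrt (\<nu> N) - 0\<bar> > \<epsilon>}
          \<subseteq> {\<omega> \<in> space M. ?D N \<omega> \<ge> \<epsilon> * sqrt (\<nu> N)}"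
        using elim by (auto simp: less_divide_eq)
      hence "prob {\<omega> \<in> space M. \<bar>?D N \<omega> / sqrt (\<nu> N) - 0\<bar> > \<epsilon>}
          \<le> prob {\<omega> \<in> space M. ?D N \<omega> \<ge> \<epsilon> * sqrt (\<nu> N)}"
        by (rule finite_measure_mono [OF _ meas])
      also have "\<dots> \<le> exp (- (\<epsilon> * sqrt (\<nu> N))) / sqrt (1 - \<gamma>)"
        using elim assms by (intro prob_ln_Z_diff_ge) auto
      finally show ?case .
    qed
  qed auto
qed

end

theorem proposition1p5:
  fixes M :: "'a measure" and g :: "'a \<Rightarrow> nat \<Rightarrow> nat \<Rightarrow> real"
    and \<beta> \<gamma> :: real and \<nu> :: "nat \<Rightarrow> real"
  assumes "prob_space M"
    and "prob_space.gaussian_disorder M g"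
    and "\<beta> \<ge> 0" and "0 \<le> \<gamma>" and "\<gamma> < 1"
  defines "\<nu> \<equiv> \<lambda>N. prob_space.variance M (\<lambda>\<omega>. ln (Z_SK \<beta> N (g \<omega>)))"
  shows "(\<forall>N\<ge>1. AE \<omega> in M. ln (Z \<beta> \<gamma> N (g \<omega>)) \<ge> ln (Z_SK \<beta> N (g \<omega>))) \<and>
    (\<forall>t\<ge>0. \<forall>N\<ge>1.
       measure M {\<omega> \<in> space M. ln (Z \<beta> \<gamma> N (g \<omega>)) - ln (Z_SK \<beta> N (g \<omega>)) \<ge> t}
         \<le> exp (- t) / sqrt (1 - \<gamma>)) \<and>
    (filterlim \<nu> at_top sequentially \<longrightarrow>
       prob_space.tendsto_in_prob M
         (\<lambda>N \<omega>. (ln (Z \<beta> \<gamma> N (g \<omega>)) - ln (Z_SK \<beta> N (g \<omega>))) / sqrt (\<nu> N)) 0)"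
proof -
  interpret prob_space M by fact
  show ?thesis
  proof (intro conjI allI impI)
    \<comment> \<open>The added exponent \<gamma> N m^2 / 2 is nonnegative, so the inequality holds
      at every \<omega>.\<close>
    show "AE \<omega> in M. ln (Z \<beta> \<gamma> N (g \<omega>)) \<ge> ln (Z_SK \<beta> N (g \<omega>))" for N
      using Z_SK_le_Z [OF \<open>0 \<le> \<gamma>\<close>] Z_SK_pos by (intro AE_I2 ln_mono) auto
  qed (use assms in \<open>auto intro!: prob_ln_Z_diff_ge ln_Z_diff_tendsto_in_prob\<close>)
qed

end
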